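(* Let $\mathcal B$ be a complex Banach space and let $(S(t))_{t\ge 0}$ be a strongly continuous semigroup of bounded operators on $\mathcal B$ with $S(0)=I$. Let $\omega\in\mathbb R$ and $p>1$, let $q$ be defined by $\frac1p+\frac1q=1$, and suppose that $K_{\omega,p}$ is finite. Let $m:[0,+\infty[\,\to\,]0,+\infty[$ be a continuous positive function such that $\|S(t)\|\le m(t)$ for all $t\ge 0$. Then for all $t,a,b>0$ such that $t\ge a+b$, $$\|S(t)\|\le K_{\omega,p}\,\frac{e^{\omega t}}{\left\|\frac1m\right\|_{e^{-\omega\cdot}L^q(]0,a[)}\,\left\|\frac1m\right\|_{e^{-\omega\cdot}L^p(]0,b[)}}.$$
   Context: $\|S(t)\|$ is the operator norm on $\mathcal L(\mathcal B)$. Here $1<p<\infty$. For an interval $I$ and $1<r<\infty$, weighted norms are $\|f\|_{e^{-\omega\cdot}L^r(I)}:=\|e^{\omega\cdot}f(\cdot)\|_{L^r(I)}$. The space $L^p_\omega(\mathbb R_+;\mathcal B)=e^{\omega\cdot}L^p(\mathbb R_+;\mathcal B)$ consists of the measurable $u:\mathbb R_+\to\mathcal B$ with norm $\left(\int_0^\infty e^{-p\omega t}\|u(t)\|_{\mathcal B}^p\,dt\right)^{1/p}<\infty$. For such $u$ set $$(\mathcal K^+u)(t)=\int_0^t S(t-s)u(s)\,ds,\qquad t\ge 0,$$ and define $K_{\omega,p}:=\|\mathcal K^+\|_{\mathcal L(L^p_\omega(\mathbb R_+;\mathcal B))}$; finiteness of $K_{\omega,p}$ means that $\mathcal K^+$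 is a bounded operator on $L^p_\omega(\mathbb R_+;\mathcal B)$. *)

theory Defs
  imports "HOL-Analysis.Analysis"
begin

class complex_banach = banach +
  fixes scaleC :: "complex \<Rightarrow> 'a \<Rightarrow> 'a"  (infixr \<open>*\<^sub>C\<close> 75)
  assumes scaleC_add_right: "c *\<^sub>C (x + y) = c *\<^sub>C x + c *\<^sub>C y"
    and scaleC_add_left: "(c + d) *\<^sub>C x = c *\<^sub>C x + d *\<^sub>C x"
    and scaleC_scaleC: "c *\<^sub>C d *\<^sub>C x = (c * d) *\<^sub>C x"
    and scaleR_scaleC: "r *\<^sub>R x = of_real r *\<^sub>C x"
    and norm_scaleC: "norm (c *\<^sub>C x) = cmod c * norm x"

instantiation complex :: complex_banach
begin

definition scaleC_complex :: "complex \<Rightarrow> complex \<Rightarrow> complex" where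
  "scaleC_complex c x = c * x"

instance
  by standard (simp_all add: scaleC_complex_def algebra_simps norm_mult scaleR_conv_of_real)

end

definition bounded_clinear :: "('a::complex_banach \<Rightarrow> 'a) \<Rightarrow> bool" where
  "bounded_clinear f \<longleftrightarrow> bounded_linear f \<and> (\<forall>c x. f (c *\<^sub>C x) = c *\<^sub>C f x)"

text \<open>Only the values \<open>S t\<close> for \<open>t \<ge> 0\<close> are constrained.\<close>

locale C0_semigroup =
  fixes S :: "real \<Rightarrow> 'a::complex_banach \<Rightarrow> 'a"
  assumes bounded_clinear: "t \<ge> 0 \<Longrightarrow> bounded_clinear (S t)"
    and zero: "S 0 = id"
    and add: "s \<ge> 0 \<Longrightarrow> t \<ge> 0 \<Longrightarrow> S (s + t) = S s \<circ> S t"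
    and strongly_continuous: "continuous_on {0..} (\<lambda>t. S t x)"

text \<open>The library's Bochner integral requires a second countable codomain, which a general
  Banach space does not have. The following definitions are those of the library without this
  requirement, with Borel measurability replaced by strong measurability. Simple functions and
  their integrals are those of the library.\<close>

definition strongly_measurable :: "'a measure \<Rightarrow> ('a \<Rightarrow> 'b::real_normed_vector) \<Rightarrow> bool" where
  "strongly_measurable M f \<longleftrightarrow>
    (\<exists>s. (\<forall>i. simple_function M (s i)) \<and> (AE x in M. (\<lambda>i::nat. s i x) \<longlonglongrightarrow> f x))"

definition has_strong_integral ::
    "'a measure \<Rightarrow> ('a \<Rightarrow> 'b::real_normed_vector) \<Rightarrow> 'b \<Rightarrow> bool" where
  "has_strong_integral M f x \<longleftrightarrow> strongly_measurable M f \<and>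
    (\<exists>s. (\<forall>i. Bochner_Integration.simple_bochner_integrable M (s i)) \<and>
      (\<lambda>i::nat. \<integral>\<^sup>+y. ennreal (norm (f y - s i y)) \<partial>M) \<longlonglongrightarrow> 0 \<and>
      (\<lambda>i. Bochner_Integration.simple_bochner_integral M (s i)) \<longlonglongrightarrow> x)"

text \<open>As in the library, the integral of a function that is not integrable is \<open>0\<close>.\<close>

definition strong_integral :: "'a measure \<Rightarrow> ('a \<Rightarrow> 'b::real_normed_vector) \<Rightarrow> 'b" where
  "strong_integral M f =
    (if \<exists>x. has_strong_integral M f x then THE x. has_strong_integral M f x else 0)"


lemma strongly_measurable_iff:
  fixes f :: "real \<Rightarrow> 'b::{real_normed_vector, second_countable_topology}"
  assumes "I \<in> sets lebesgue"
  shows "strongly_measurable (lebesgue_on I) f \<longleftrightarrow> f \<in> borel_measurable (lebesgue_on I)"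
proof
  assume "f \<in> borel_measurable (lebesgue_on I)"
  from borel_measurable_implies_sequence_metric[OF this, of 0]
  show "strongly_measurable (lebesgue_on I) f"
    unfolding strongly_measurable_def by (blast intro: AE_I2)
next
  assume "strongly_measurable (lebesgue_on I) f"
  then obtain s where s: "\<And>i::nat. simple_function (lebesgue_on I) (s i)"
    and lim: "AE x in lebesgue_on I. (\<lambda>i. s i x) \<longlonglongrightarrow> f x"
    unfolding strongly_measurable_def by auto
  from lim obtain N where N: "N \<in> null_sets (lebesgue_on I)"
    "{x\<in>space (lebesgue_on I). \<not> (\<lambda>i. s i x) \<longlonglongrightarrow> f x} \<subseteq> N"
    unfolding eventually_ae_filter by auto
  define g where "g = (\<lambda>x. if x \<in> N then 0 else f x)"
  have g: "g \<in> borel_measurable (lebesgue_on I)"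
    unfolding g_def
  proof (rule borel_measurable_LIMSEQ_metric)
    show "(\<lambda>x. if x \<in> N then 0 else s i x) \<in> borel_measurable (lebesgue_on I)" for i
      using borel_measurable_simple_function[OF s[of i]] N by (intro measurable_If_set) auto
    show "(\<lambda>i. if x \<in> N then 0 else s i x) \<longlonglongrightarrow> (if x \<in> N then 0 else f x)"
      if "x \<in> space (lebesgue_on I)" for x
      using N that by auto
  qed
  have null: "A \<in> sets (lebesgue_on I)" if "A \<subseteq> N" for A
  proof -
    have "N \<in> null_sets lebesgue" using N(1) assms by (simp add: null_sets_restrict_space)
    then have "A \<in> null_sets lebesgue" using that
      by (rule_tac complete_measure.complete2[OF completion.complete_measure_axioms]) auto
    then show ?thesis using that N(1) assms sets.sets_into_space[OF null_setsD2[OF N(1)]]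
      by (auto simp: sets_restrict_space_iff)
  qed
  show "f \<in> borel_measurable (lebesgue_on I)"
  proof (rule measurableI)
    fix B :: "'b set" assume B: "B \<in> sets borel"
    let ?V = "\<lambda>h. h -` B \<inter> space (lebesgue_on I)"
    have "?V f = (?V g - N) \<union> (?V f \<inter> N)"
      by (auto simp: g_def)
    moreover have "?V g - N \<in> sets (lebesgue_on I)"
      using measurable_sets[OF g B] N(1) by auto
    ultimately show "?V f \<in> sets (lebesgue_on I)"
      using null[of "?V f \<inter> N"] by (metis Int_lower2 sets.Un)
  qed simp
qed

lemma has_strong_integral_iff:
  fixes f :: "real \<Rightarrow> 'b::{real_normed_vector, second_countable_topology}"
  assumes "I \<in> sets lebesgue"
  shows "has_strong_integral (lebesgue_on I) f x \<longleftrightarrow> has_bochner_integral (lebesgue_on I) f x"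
  unfolding has_strong_integral_def has_bochner_integral.simps strongly_measurable_iff[OF assms]
  by auto

definition Lr_norm :: "real set \<Rightarrow> real \<Rightarrow> (real \<Rightarrow> 'b::real_normed_vector) \<Rightarrow> real" where
  "Lr_norm I r f = (LINT t|lebesgue_on I. norm (f t) powr r) powr (1 / r)"

text \<open>The norm of \<open>e\<^sup>-\<^sup>\<omega>\<^sup>\<cdot> L\<^sup>r(I)\<close>.\<close>

definition weighted_Lr_norm :: "real \<Rightarrow> real \<Rightarrow> real set \<Rightarrow> (real \<Rightarrow> 'b::real_normed_vector) \<Rightarrow> real" where
  "weighted_Lr_norm \<omega> r I f = Lr_norm I r (\<lambda>t. exp (\<omega> * t) *\<^sub>R f t)"

definition Lp_omega :: "real \<Rightarrow> real \<Rightarrow> (real \<Rightarrow> 'b::real_normed_vector) set" where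
  "Lp_omega \<omega> p = {u. strongly_measurable (lebesgue_on {0..}) u \<and>
    integrable (lebesgue_on {0..}) (\<lambda>t. exp (- p * \<omega> * t) * norm (u t) powr p)}"

definition Lp_omega_norm :: "real \<Rightarrow> real \<Rightarrow> (real \<Rightarrow> 'b::real_normed_vector) \<Rightarrow> real" where
  "Lp_omega_norm \<omega> p u =
    (LINT t|lebesgue_on {0..}. exp (- p * \<omega> * t) * norm (u t) powr p) powr (1 / p)"

definition K_plus :: "(real \<Rightarrow> 'b::real_normed_vector \<Rightarrow> 'b) \<Rightarrow> (real \<Rightarrow> 'b) \<Rightarrow> real \<Rightarrow> 'b" where
  "K_plus S u t = strong_integral (lebesgue_on {0..t}) (\<lambda>s. S (t - s) (u s))"

text \<open>The operator norm of \<open>\<K>\<^sup>+\<close> on \<open>L\<^sup>p\<^sub>\<omega>\<close>, as the least admissible constant. It is \<open>\<infinity>\<close> (the infimum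
  of the empty set) if \<open>\<K>\<^sup>+\<close> does not map \<open>L\<^sup>p\<^sub>\<omega>\<close> boundedly into itself.\<close>

definition K_norm :: "(real \<Rightarrow> 'b::real_normed_vector \<Rightarrow> 'b) \<Rightarrow> real \<Rightarrow> real \<Rightarrow> ennreal" where
  "K_norm S \<omega> p = (INF C \<in> {C. 0 \<le> C \<and> (\<forall>u \<in> Lp_omega \<omega> p. K_plus S u \<in> Lp_omega \<omega> p \<and>
      Lp_omega_norm \<omega> p (K_plus S u) \<le> C * Lp_omega_norm \<omega> p u)}.
    ennreal C)"

end

theory Submission
  imports Defs
begin

text \<open>Put \<open>h s = exp (\<omega> s) / m s\<close> and apply \<open>\<K>\<^sup>+\<close> to \<open>u s = f s S(s)x\<close> with \<open>f\<close> supported in \<open>]0,a[\<close>. By the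
  semigroup law the integrand of \<open>(\<K>\<^sup>+ u)(r)\<close> is \<open>f s S(r)x\<close>, so \<open>(\<K>\<^sup>+ u)(r) = (\<integral>f) S(r)x\<close> for
  \<open>r \<ge> a\<close>. Since \<open>\<parallel>S(r)x\<parallel> \<ge> \<parallel>S(t)x\<parallel> / m (t - r)\<close>, the part of the norm of \<open>\<K>\<^sup>+ u\<close> over \<open>]t-b,t[\<close> bounds
  \<open>(\<integral>f) exp (-\<omega> t) \<parallel>S(t)x\<parallel>\<close> times the \<open>L\<^sup>p\<close> norm of \<open>h\<close> over \<open>]0,b[\<close>, while the norm of \<open>u\<close> is at most \<open>\<parallel>x\<parallel>\<close>
  times the \<open>L\<^sup>p\<close> norm of \<open>f / h\<close>. The choice \<open>f = h\<^sup>q\<close> is the case of equality in Hoelder's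
  inequality for \<open>\<integral>f = \<integral>(f / h) h\<close>.\<close>

section \<open>Strong integrals: uniqueness, and scalar functions times a fixed vector\<close>

text \<open>Two approximating sequences are both close to \<open>f\<close> in mean, hence close to
  each other, and the norm of the integral of a simple function is at most the integral of its norm.
  Splitting the integral of the sum of the two distances requires measurable integrands, which
  \<open>meas\<close> supplies.\<close>

lemma has_strong_integral_unique:
  fixes f :: "'a \<Rightarrow> 'b::real_normed_vector"
  assumes meas: "\<And>c. (\<lambda>x. norm (f x - c)) \<in> borel_measurable M"
    and x: "has_strong_integral M f x" and y: "has_strong_integral M f y"
  shows "x = y"
proof -
  let ?I = "Bochner_Integration.simple_bochner_integral M"
  obtain s where s: "\<And>i. Bochner_Integration.simple_bochner_integrable M (s i)"
    and s0: "(\<lambda>i::nat. \<integral>\<^sup>+z. ennreal (norm (f z - s i z)) \<partial>M) \<longlonglongrightarrow> 0"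
    and sx: "(\<lambda>i. ?I (s i)) \<longlonglongrightarrow> x"
    using x unfolding has_strong_integral_def by blast
  obtain t where t: "\<And>i. Bochner_Integration.simple_bochner_integrable M (t i)"
    and t0: "(\<lambda>i::nat. \<integral>\<^sup>+z. ennreal (norm (f z - t i z)) \<partial>M) \<longlonglongrightarrow> 0"
    and ty: "(\<lambda>i. ?I (t i)) \<longlonglongrightarrow> y"
    using y unfolding has_strong_integral_def by blast
  \<comment> \<open>\<open>g\<close> has finitely many values, and where it equals \<open>c\<close>
    the function is \<open>norm (f z - c)\<close>; measurability is glued from these pieces.\<close>
  have dist_meas: "(\<lambda>z. ennreal (norm (f z - g z))) \<in> borel_measurable M"
    if "Bochner_Integration.simple_bochner_integrable M g" for g
  proof -
    have g: "simple_function M g"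
      using that by (auto elim: Bochner_Integration.simple_bochner_integrable.cases)
    have "g \<in> measurable M (count_space (g ` space M))"
      using g by (auto simp: simple_function_def measurable_count_space_eq2)
    from measurable_compose_countable'[OF meas this] g
    have "(\<lambda>z. norm (f z - g z)) \<in> borel_measurable M"
      by (auto simp: simple_function_def countable_finite)
    then show ?thesis by measurable
  qed
  have le: "ennreal (norm (?I (s i) - ?I (t i))) \<le>
      (\<integral>\<^sup>+z. ennreal (norm (f z - s i z)) \<partial>M) + (\<integral>\<^sup>+z. ennreal (norm (f z - t i z)) \<partial>M)" for i
  proof -
    have d: "Bochner_Integration.simple_bochner_integrable M (\<lambda>z. s i z - t i z)"
      by (rule simple_bochner_integrable_compose2[OF _ s t]) simp
    have nd: "Bochner_Integration.simple_bochner_integrable M (\<lambda>z. norm (s i z - t i z))"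
      using simple_bochner_integrable_compose2[OF _ d d, of "\<lambda>u v. norm u"] by simp
    have "ennreal (norm (?I (s i) - ?I (t i))) \<le> ennreal (?I (\<lambda>z. norm (s i z - t i z)))"
      using simple_bochner_integral_norm_bound[OF d] simple_bochner_integral_diff[OF s t]
      by (simp add: ennreal_leI)
    also have "\<dots> = (\<integral>\<^sup>+z. ennreal (norm (s i z - t i z)) \<partial>M)"
      by (rule simple_bochner_integral_eq_nn_integral[OF nd]) simp
    also have "\<dots> \<le> (\<integral>\<^sup>+z. ennreal (norm (f z - s i z)) + ennreal (norm (f z - t i z)) \<partial>M)"
    proof (rule nn_integral_mono)
      fix z
      have "norm (s i z - t i z) \<le> norm (f z - s i z) + norm (f z - t i z)"
        using norm_triangle_ineq4[of "f z - t i z" "f z - s i z"] by simp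
      then show "ennreal (norm (s i z - t i z)) \<le>
          ennreal (norm (f z - s i z)) + ennreal (norm (f z - t i z))"
        by (simp flip: ennreal_plus)
    qed
    also have "\<dots> = (\<integral>\<^sup>+z. ennreal (norm (f z - s i z)) \<partial>M) + (\<integral>\<^sup>+z. ennreal (norm (f z - t i z)) \<partial>M)"
      by (intro nn_integral_add dist_meas s t)
    finally show ?thesis .
  qed
  have "(\<lambda>i. ennreal (norm (?I (s i) - ?I (t i)))) \<longlonglongrightarrow> ennreal (norm (x - y))"
    by (intro tendsto_ennrealI tendsto_norm tendsto_diff sx ty)
  moreover have "(\<lambda>i. (\<integral>\<^sup>+z. ennreal (norm (f z - s i z)) \<partial>M) + (\<integral>\<^sup>+z. ennreal (norm (f z - t i z)) \<partial>M))
      \<longlonglongrightarrow> 0 + 0"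
    by (intro tendsto_add s0 t0)
  ultimately have "ennreal (norm (x - y)) \<le> 0 + 0"
    by (rule LIMSEQ_le) (use le in auto)
  then show ?thesis by simp
qed

text \<open>Multiplying simple approximants of \<open>g\<close> by \<open>v\<close> scales their
  mean distance to the limit by \<open>norm v\<close>.\<close>

lemma has_strong_integral_scaleR_left:
  fixes v :: "'b::real_normed_vector" and g :: "'a \<Rightarrow> real"
  assumes "has_bochner_integral M g J"
  shows "has_strong_integral M (\<lambda>x. g x *\<^sub>R v) (J *\<^sub>R v)"
proof -
  obtain s where g: "g \<in> borel_measurable M"
    and s: "\<And>i. Bochner_Integration.simple_bochner_integrable M (s i)"
    and s0: "(\<lambda>i::nat. \<integral>\<^sup>+z. ennreal (norm (g z - s i z)) \<partial>M) \<longlonglongrightarrow> 0"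
    and sJ: "(\<lambda>i. Bochner_Integration.simple_bochner_integral M (s i)) \<longlonglongrightarrow> J"
    using assms by (auto simp: has_bochner_integral.simps)
  obtain r where r: "\<And>i. simple_function M (r i)"
      "\<And>x. x \<in> space M \<Longrightarrow> (\<lambda>i::nat. r i x) \<longlonglongrightarrow> g x"
    using borel_measurable_implies_sequence_metric[OF g, of 0] by blast
  have meas: "strongly_measurable M (\<lambda>x. g x *\<^sub>R v)"
    unfolding strongly_measurable_def
  proof (intro exI[of _ "\<lambda>i x. r i x *\<^sub>R v"] conjI allI AE_I2)
    show "simple_function M (\<lambda>x. r i x *\<^sub>R v)" for i
      using simple_function_compose1[OF r(1)[of i], of "\<lambda>c. c *\<^sub>R v"] .
    show "(\<lambda>i. r i x *\<^sub>R v) \<longlonglongrightarrow> g x *\<^sub>R v" if "x \<in> space M" for x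
      by (intro tendsto_intros r that)
  qed
  have int: "Bochner_Integration.simple_bochner_integrable M (\<lambda>x. s i x *\<^sub>R v)" for i
    using simple_bochner_integrable_compose2[OF _ s s, of "\<lambda>c d. c *\<^sub>R v"] by simp
  have "(\<lambda>i. ennreal (norm v) * \<integral>\<^sup>+z. ennreal (norm (g z - s i z)) \<partial>M) \<longlonglongrightarrow> ennreal (norm v) * 0"
    by (intro ennreal_tendsto_cmult s0) simp
  moreover have "(\<integral>\<^sup>+z. ennreal (norm (g z *\<^sub>R v - s i z *\<^sub>R v)) \<partial>M) =
      ennreal (norm v) * \<integral>\<^sup>+z. ennreal (norm (g z - s i z)) \<partial>M" for i
  proof -
    have [measurable]: "s i \<in> borel_measurable M"
      using s[of i] by (auto elim: Bochner_Integration.simple_bochner_integrable.cases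
          intro: borel_measurable_simple_function)
    note g[measurable]
    have "(\<integral>\<^sup>+z. ennreal (norm (g z *\<^sub>R v - s i z *\<^sub>R v)) \<partial>M) =
        (\<integral>\<^sup>+z. ennreal (norm v) * ennreal (norm (g z - s i z)) \<partial>M)"
      by (simp add: mult.commute flip: scaleR_left_diff_distrib ennreal_mult)
    also have "\<dots> = ennreal (norm v) * \<integral>\<^sup>+z. ennreal (norm (g z - s i z)) \<partial>M"
      by (rule nn_integral_cmult) measurable
    finally show ?thesis .
  qed
  ultimately have lim: "(\<lambda>i. \<integral>\<^sup>+z. ennreal (norm (g z *\<^sub>R v - s i z *\<^sub>R v)) \<partial>M) \<longlonglongrightarrow> 0"
    by simp
  have "Bochner_Integration.simple_bochner_integral M (\<lambda>x. s i x *\<^sub>R v) =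
      Bochner_Integration.simple_bochner_integral M (s i) *\<^sub>R v" for i
    by (rule simple_bochner_integral_linear[OF _ s])
       (intro bounded_linear.linear bounded_linear_scaleR_left)
  then have "(\<lambda>i. Bochner_Integration.simple_bochner_integral M (\<lambda>x. s i x *\<^sub>R v)) \<longlonglongrightarrow> J *\<^sub>R v"
    by (simp add: sJ tendsto_scaleR)
  with meas int lim show ?thesis
    unfolding has_strong_integral_def by (intro conjI exI[of _ "\<lambda>i x. s i x *\<^sub>R v"]) auto
qed

lemma has_strong_integral_cong:
  assumes "\<And>x. x \<in> space M \<Longrightarrow> f x = g x"
  shows "has_strong_integral M f y \<longleftrightarrow> has_strong_integral M g y"
proof -
  have "strongly_measurable M f \<longleftrightarrow> strongly_measurable M g"
    unfolding strongly_measurable_def using assms by (simp cong: AE_cong_simp)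
  moreover have "(\<integral>\<^sup>+z. ennreal (norm (f z - s z)) \<partial>M) = (\<integral>\<^sup>+z. ennreal (norm (g z - s z)) \<partial>M)" for s
    using assms by (intro nn_integral_cong) simp
  ultimately show ?thesis
    unfolding has_strong_integral_def by simp
qed

text \<open>This evaluates \<open>K_plus\<close> on the test functions: there the semigroup law
  turns the integrand into a scalar function times a vector independent of the integration
  variable.\<close>

lemma strong_integral_scaleR_left:
  fixes v :: "'b::real_normed_vector" and g :: "'a \<Rightarrow> real"
  assumes g: "has_bochner_integral M g J"
    and f: "\<And>x. x \<in> space M \<Longrightarrow> f x = g x *\<^sub>R v"
  shows "strong_integral M f = J *\<^sub>R v"
proof -
  have iff: "has_strong_integral M f y \<longleftrightarrow> has_strong_integral M (\<lambda>x. g x *\<^sub>R v) y" for y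
    by (rule has_strong_integral_cong[OF f])
  have [measurable]: "g \<in> borel_measurable M"
    using g by (auto elim: has_bochner_integral.cases)
  \<comment> \<open>All values lie on the real line spanned by \<open>v\<close>, so the distance to
    \<open>c\<close> is a continuous function of the real number \<open>g x\<close>; this is the
    measurability that uniqueness asks for.\<close>
  have "(\<lambda>x. norm (g x *\<^sub>R v - c)) \<in> borel_measurable M" for c
  proof -
    have "(\<lambda>r::real. norm (r *\<^sub>R v - c)) \<in> borel_measurable borel"
      by (intro borel_measurable_continuous_onI continuous_intros)
    then show ?thesis by measurable
  qed
  note unique = has_strong_integral_unique[OF this]
  have J: "has_strong_integral M f (J *\<^sub>R v)"
    unfolding iff by (rule has_strong_integral_scaleR_left[OF g])
  then have "(THE y. has_strong_integral M f y) = J *\<^sub>R v"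
    using unique unfolding iff by blast
  with J show ?thesis
    unfolding strong_integral_def by metis
qed

section \<open>Strong measurability of truncated continuous functions\<close>

text \<open>Sampling \<open>w\<close> on a grid yields finitely many values over a bounded interval,
  and refining the grid gives pointwise convergence by continuity.\<close>

lemma strongly_measurable_continuous_Ioo:
  fixes w :: "real \<Rightarrow> 'b::real_normed_vector"
  assumes "continuous_on {0..} w"
  shows "strongly_measurable (lebesgue_on {0..}) (\<lambda>t. indicator {0<..<a} t *\<^sub>R w t)"
proof -
  \<comment> \<open>\<open>r n t\<close> rounds \<open>t\<close> down to the grid of width \<open>1 / Suc n\<close>; the value \<open>-1\<close> marks \<open>t \<notin> {0<..<a}\<close>.\<close>
  define r where "r n t = (if t \<in> {0<..<a} then of_int \<lfloor>t * Suc n\<rfloor> / Suc n else -1)"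
    for n :: nat and t :: real
  \<comment> \<open>\<open>W\<close> sends the marker \<open>-1\<close> to 0 and agrees with
    \<open>w\<close> at the grid points, which are nonnegative.\<close>
  define W where "W t = (if t < 0 then 0 else w t)" for t
  have r_simple: "simple_function (lebesgue_on {0..}) (r n)" for n
  proof (rule simple_function_borel_measurable)
    have "r n \<in> borel_measurable borel"
      unfolding r_def by measurable
    then show "r n \<in> borel_measurable (lebesgue_on {0..})"
      by (simp add: measurable_completion measurable_restrict_space1)
    have "r n t \<in> insert (-1) ((\<lambda>k. of_int k / Suc n) ` {0..\<lceil>a * Suc n\<rceil>})" for t
    proof (cases "t \<in> {0<..<a}")
      case True
      then have "t * Suc n \<le> a * Suc n" by (intro mult_right_mono) auto
      then have "\<lfloor>t * Suc n\<rfloor> \<le> \<lceil>a * Suc n\<rceil>" by linarith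
      moreover have "0 \<le> \<lfloor>t * Suc n\<rfloor>" using True by simp
      ultimately show ?thesis using True by (auto simp: r_def)
    qed (auto simp: r_def)
    then show "finite (r n ` space (lebesgue_on {0..}))"
      by (intro finite_subset[OF _ finite.insertI[OF finite_imageI[OF finite_atLeastAtMost_int]]]) blast
  qed
  show ?thesis
    unfolding strongly_measurable_def
  proof (intro exI[of _ "\<lambda>n t. W (r n t)"] conjI allI AE_I2)
    show "simple_function (lebesgue_on {0..}) (\<lambda>t. W (r n t))" for n
      by (rule simple_function_compose1[OF r_simple])
    fix t
    show "(\<lambda>n. W (r n t)) \<longlonglongrightarrow> indicator {0<..<a} t *\<^sub>R w t"
    proof (cases "t \<in> {0<..<a}")
      case True
      have r0: "r n t \<ge> 0" for n using True by (simp add: r_def)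
      have "(\<lambda>n. r n t) \<longlonglongrightarrow> t"
      proof (rule tendsto_sandwich)
        have "t - inverse (real (Suc n)) \<le> r n t" for n
        proof -
          have "t * Suc n - 1 \<le> of_int \<lfloor>t * Suc n\<rfloor>" by linarith
          then have "(t * Suc n - 1) / Suc n \<le> of_int \<lfloor>t * Suc n\<rfloor> / Suc n"
            by (intro divide_right_mono) auto
          then show ?thesis using True by (simp add: r_def diff_divide_distrib inverse_eq_divide)
        qed
        then show "\<forall>\<^sub>F n in sequentially. t - inverse (real (Suc n)) \<le> r n t" by simp
        have "r n t \<le> t" for n
          using True by (simp add: r_def divide_le_eq)
        then show "\<forall>\<^sub>F n in sequentially. r n t \<le> t" by simp
        show "(\<lambda>n. t - inverse (real (Suc n))) \<longlonglongrightarrow> t"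
          using tendsto_diff[OF tendsto_const LIMSEQ_inverse_real_of_nat] by simp
      qed simp
      then have "(\<lambda>n. w (r n t)) \<longlonglongrightarrow> w t"
        using r0 True by (intro continuous_on_tendsto_compose[OF assms]) auto
      then show ?thesis using r0 True by (simp add: W_def not_less[symmetric])
    qed (auto simp: r_def W_def)
  qed
qed

section \<open>Scalar integrals over bounded open intervals\<close>

lemma integrable_continuous_Ioo:
  fixes f :: "real \<Rightarrow> real"
  assumes "continuous_on {0..} f"
  shows "integrable lborel (\<lambda>s. indicator {0<..<c} s * f s)"
proof -
  have "set_integrable lborel {0..c} f"
    by (intro borel_integrable_atLeastAtMost' continuous_on_subset[OF assms]) auto
  from set_integrable_subset[OF this, of "{0<..<c}"] show ?thesis
    by (simp add: set_integrable_def greaterThanLessThan_subseteq_atLeastAtMost_iff)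
qed

text \<open>A single \<open>lborel\<close> form serves all three domains in use:
  \<open>{0..r}\<close> for \<open>K_plus\<close>, \<open>{0..}\<close> for \<open>Lp_omega\<close>,
  and \<open>{0<..<c}\<close> for the weighted norms.\<close>

lemma has_bochner_integral_lebesgue_on_Ioo:
  fixes f :: "real \<Rightarrow> real"
  assumes cont: "continuous_on {0..} f" and A: "{0<..<c} \<subseteq> A" "A \<in> sets lebesgue"
  shows "has_bochner_integral (lebesgue_on A) (\<lambda>s. indicator {0<..<c} s * f s)
    (LINT s|lborel. indicator {0<..<c} s * f s)"
proof -
  let ?g = "\<lambda>s. indicator {0<..<c} s * f s"
  have int: "integrable lborel ?g"
    by (rule integrable_continuous_Ioo[OF cont])
  then have meas: "?g \<in> borel_measurable lborel"
    by (rule borel_measurable_integrable)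
  have g: "(\<lambda>s. indicator A s *\<^sub>R ?g s) = ?g"
    using A(1) by (auto simp: fun_eq_iff indicator_def)
  show ?thesis
    using A(2) int
    by (simp add: has_bochner_integral_iff integrable_restrict_space integral_restrict_space g
        integrable_completion[OF meas] integral_completion[OF meas] del: real_scaleR_def)
qed

lemma LINT_lebesgue_on_Ioo:
  fixes f :: "real \<Rightarrow> real"
  assumes "continuous_on {0..} f"
  shows "(LINT s|lebesgue_on {0<..<c}. f s) = (LINT s|lborel. indicator {0<..<c} s * f s)"
proof -
  have "(LINT s|lebesgue_on {0<..<c}. f s) = (LINT s|lebesgue_on {0<..<c}. indicator {0<..<c} s * f s)"
    by (intro Bochner_Integration.integral_cong) auto
  also have "\<dots> = (LINT s|lborel. indicator {0<..<c} s * f s)"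
    by (intro has_bochner_integral_integral_eq has_bochner_integral_lebesgue_on_Ioo assms) auto
  finally show ?thesis .
qed

text \<open>On the compact interval \<open>{0..c}\<close> the function attains a positive minimum,
  and the integral is at least \<open>c\<close> times it. This is what permits division by the
  weighted norms.\<close>

lemma LINT_Ioo_pos:
  fixes f :: "real \<Rightarrow> real"
  assumes cont: "continuous_on {0..} f" and pos: "\<And>s. s \<ge> 0 \<Longrightarrow> f s > 0" and c: "c > 0"
  shows "(LINT s|lborel. indicator {0<..<c} s * f s) > 0"
proof -
  obtain z where z: "z \<in> {0..c}" "\<And>s. s \<in> {0..c} \<Longrightarrow> f z \<le> f s"
    using continuous_attains_inf[of "{0..c}" f] continuous_on_subset[OF cont, of "{0..c}"] c by auto
  have "0 < c * f z" using c z(1) pos[of z] by simp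
  also have "\<dots> = (LINT s|lborel. indicator {0<..<c} s * f z)" using c by simp
  also have "\<dots> \<le> (LINT s|lborel. indicator {0<..<c} s * f s)"
    using z pos by (intro integral_mono' integrable_continuous_Ioo cont)
      (auto simp: indicator_def less_imp_le)
  finally show ?thesis .
qed

lemma continuous_on_exp_divide_powr:
  fixes m :: "real \<Rightarrow> real"
  assumes "continuous_on {0..} m" and "\<And>t. t \<ge> 0 \<Longrightarrow> m t > 0"
  shows "continuous_on {0..} (\<lambda>s. (exp (\<omega> * s) / m s) powr r)"
proof -
  have "m t \<noteq> 0" if "t \<ge> 0" for t
    using assms(2)[OF that] by simp
  then show ?thesis
    by (intro continuous_on_powr continuous_intros assms(1)) auto
qed

lemma weighted_Lr_norm_inverse:
  assumes "continuous_on {0..} m" and "\<And>t. t \<ge> 0 \<Longrightarrow> m t > 0"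
  shows "weighted_Lr_norm \<omega> r {0<..<c} (\<lambda>s. 1 / m s) =
    (LINT s|lborel. indicator {0<..<c} s * (exp (\<omega> * s) / m s) powr r) powr (1 / r)"
proof -
  have "(LINT s|lebesgue_on {0<..<c}. norm (exp (\<omega> * s) *\<^sub>R (1 / m s)) powr r) =
      (LINT s|lebesgue_on {0<..<c}. (exp (\<omega> * s) / m s) powr r)"
    using assms(2) by (intro Bochner_Integration.integral_cong) (auto simp: less_imp_le abs_of_pos)
  also have "\<dots> = (LINT s|lborel. indicator {0<..<c} s * (exp (\<omega> * s) / m s) powr r)"
    by (intro LINT_lebesgue_on_Ioo continuous_on_exp_divide_powr assms)
  finally show ?thesis unfolding weighted_Lr_norm_def Lr_norm_def by simp
qed

section \<open>The test function and the estimate for one admissible constant\<close>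

context C0_semigroup
begin

lemma bounded_linear: "t \<ge> 0 \<Longrightarrow> bounded_linear (S t)"
  using bounded_clinear by (auto simp: bounded_clinear_def)

text \<open>Since \<open>a \<le> r\<close>, the whole support \<open>]0,a[\<close> lies in the
  domain of integration, so the scalar factor is the same for every such \<open>r\<close>.\<close>

lemma K_plus_eq:
  assumes f: "continuous_on {0..} f" and "a \<le> r" "0 \<le> r"
  shows "K_plus S (\<lambda>s. indicator {0<..<a} s *\<^sub>R (f s *\<^sub>R S s x)) r =
    (LINT s|lborel. indicator {0<..<a} s * f s) *\<^sub>R S r x"
  unfolding K_plus_def
proof (rule strong_integral_scaleR_left)
  show "has_bochner_integral (lebesgue_on {0..r}) (\<lambda>s. indicator {0<..<a} s * f s)
      (LINT s|lborel. indicator {0<..<a} s * f s)"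
    using \<open>a \<le> r\<close> by (intro has_bochner_integral_lebesgue_on_Ioo f) auto
  fix s assume "s \<in> space (lebesgue_on {0..r})"
  then have s: "0 \<le> s" "s \<le> r" by auto
  have "S (r - s) (S s x) = S r x"
    using add[of "r - s" s] s by (simp add: fun_eq_iff)
  then show "S (r - s) (indicator {0<..<a} s *\<^sub>R (f s *\<^sub>R S s x)) =
      (indicator {0<..<a} s * f s) *\<^sub>R S r x"
    using s by (simp add: bounded_linear.linear[OF bounded_linear] linear_scale)
qed

text \<open>\<open>J powr (1 / q)\<close> and \<open>I powr (1 / p)\<close> are the two weighted
  norms of \<open>1 / m\<close>. Fixing one vector \<open>x\<close> and one bound \<open>C\<close>
  for the operator leaves the infimum over \<open>C\<close> and the passage to
  \<open>onorm (S t)\<close> for afterwards.\<close>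

lemma norm_le_K_plus_constant:
  fixes \<omega> p q a b t C :: real and m :: "real \<Rightarrow> real" and x :: 'a
  defines "h \<equiv> \<lambda>s. exp (\<omega> * s) / m s"
  defines "J \<equiv> LINT s|lborel. indicator {0<..<a} s * h s powr q"
    and "I \<equiv> LINT s|lborel. indicator {0<..<b} s * h s powr p"
  assumes p: "p > 1" and pq: "1 / p + 1 / q = 1"
    and m: "continuous_on {0..} m" and m_pos: "\<And>t. t \<ge> 0 \<Longrightarrow> m t > 0"
    and S_m: "\<And>t. t \<ge> 0 \<Longrightarrow> onorm (S t) \<le> m t"
    and C: "C \<ge> 0" "\<And>u. u \<in> Lp_omega \<omega> p \<Longrightarrow> K_plus S u \<in> Lp_omega \<omega> p \<and>
      Lp_omega_norm \<omega> p (K_plus S u) \<le> C * Lp_omega_norm \<omega> p u"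
    and ab: "a > 0" "b > 0" "t \<ge> a + b"
  shows "norm (S t x) * (J powr (1 / q) * I powr (1 / p)) \<le> C * exp (\<omega> * t) * norm x"
proof -
  have h_pos: "h s > 0" if "s \<ge> 0" for s
    using m_pos[OF that] by (simp add: h_def)
  have hr_cont: "continuous_on {0..} (\<lambda>s. h s powr r)" for r
    unfolding h_def by (intro continuous_on_exp_divide_powr m m_pos)
  have h_powr_pos: "h s powr r > 0" if "s \<ge> 0" for s r
    using h_pos[OF that] by simp
  have J_pos: "J > 0" and I_pos: "I > 0"
    unfolding J_def I_def using ab by (auto intro!: LINT_Ioo_pos hr_cont h_powr_pos simp del: powr_gt_zero)
  have S_le: "norm (S s y) \<le> m s * norm y" if "s \<ge> 0" for s y
    using order_trans[OF onorm[OF bounded_linear[OF that]] mult_right_mono[OF S_m[OF that] norm_ge_zero]] .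
  \<comment> \<open>This is the exponent of \<open>h\<close> in
    \<open>(h powr q / h) powr p\<close>.\<close>
  have qp: "q * p - p = q"
  proof -
    have "q \<noteq> 0" using p pq by auto
    then show ?thesis using p pq by (simp add: field_simps)
  qed

  \<comment> \<open>With \<open>f = h powr q\<close>, the integral of \<open>f\<close> and the
    integral of \<open>(f / h) powr p\<close> are both \<open>J\<close>.\<close>
  define u where "u s = indicator {0<..<a} s *\<^sub>R (h s powr q *\<^sub>R S s x)" for s
  let ?F = "\<lambda>s. exp (- p * \<omega> * s) * norm (h s powr q *\<^sub>R S s x) powr p"
  have uF: "exp (- p * \<omega> * s) * norm (u s) powr p = indicator {0<..<a} s * ?F s" for s
    using p by (simp add: u_def indicator_def)
  have w_cont: "continuous_on {0..} (\<lambda>s. h s powr q *\<^sub>R S s x)"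
    by (intro continuous_intros hr_cont strongly_continuous)
  have F_cont: "continuous_on {0..} ?F"
    using p by (intro continuous_intros continuous_on_powr' w_cont) auto
  \<comment> \<open>Bounding \<open>norm (S s x)\<close> by \<open>m s * norm x\<close> with
    \<open>m s = exp (\<omega> * s) / h s\<close> makes the weight
    \<open>exp (- p * \<omega> * s)\<close> cancel.\<close>
  have F_le: "?F s \<le> norm x powr p * h s powr q" if "s \<ge> 0" for s
  proof -
    have ms: "m s = exp (\<omega> * s) / h s"
      using m_pos[OF that] by (simp add: h_def)
    have "norm (h s powr q *\<^sub>R S s x) \<le> h s powr q * (m s * norm x)"
      using S_le[OF that, of x] by (simp add: mult_left_mono)
    then have "?F s \<le> exp (- p * \<omega> * s) * (h s powr q * (m s * norm x)) powr p"
      using p by (intro mult_left_mono powr_mono2) auto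
    also have "\<dots> = exp (- p * \<omega> * s) * ((h s powr (q * p) * (exp (\<omega> * s) powr p / h s powr p)) * norm x powr p)"
      using h_pos[OF that] by (simp add: ms powr_mult powr_divide powr_powr)
    also have "\<dots> = (exp (- p * \<omega> * s) * exp (\<omega> * s) powr p) * (h s powr (q * p - p)) * norm x powr p"
      by (simp add: powr_diff)
    also have "exp (- p * \<omega> * s) * exp (\<omega> * s) powr p = 1"
      by (simp add: powr_def mult_ac flip: exp_add)
    finally show ?thesis unfolding qp by (simp add: mult.commute)
  qed
  have u_int: "has_bochner_integral (lebesgue_on {0..}) (\<lambda>s. exp (- p * \<omega> * s) * norm (u s) powr p)
      (LINT s|lborel. indicator {0<..<a} s * ?F s)"
    unfolding uF by (intro has_bochner_integral_lebesgue_on_Ioo F_cont) auto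
  have "strongly_measurable (lebesgue_on {0..}) u"
    unfolding u_def by (rule strongly_measurable_continuous_Ioo[OF w_cont])
  then have u: "u \<in> Lp_omega \<omega> p"
    using u_int by (auto simp: Lp_omega_def has_bochner_integral_iff)
  have "(LINT s|lborel. indicator {0<..<a} s * ?F s) \<le>
      (LINT s|lborel. norm x powr p * (indicator {0<..<a} s * h s powr q))"
    using F_le by (intro integral_mono' integrable_mult_right integrable_continuous_Ioo hr_cont)
      (auto simp: indicator_def)
  also have "\<dots> = norm x powr p * J"
    by (simp add: J_def)
  finally have "Lp_omega_norm \<omega> p u \<le> (norm x powr p * J) powr (1 / p)"
    unfolding Lp_omega_norm_def has_bochner_integral_integral_eq[OF u_int]
    using p by (intro powr_mono2 Bochner_Integration.integral_nonneg) auto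
  also have "\<dots> = norm x * J powr (1 / p)"
    using p J_pos by (simp add: powr_mult powr_powr)
  finally have u_le: "Lp_omega_norm \<omega> p u \<le> norm x * J powr (1 / p)" .

  define G where "G r = exp (- p * \<omega> * r) * norm (K_plus S u r) powr p" for r
  \<comment> \<open>\<open>c\<close> collects the factors free of \<open>r\<close>: writing
    \<open>exp (- \<omega> * r)\<close> as
    \<open>exp (- \<omega> * t) * exp (\<omega> * (t - r))\<close>, the last factor joins
    \<open>1 / m (t - r)\<close> to form \<open>h (t - r)\<close>.\<close>
  define c where "c = (J * norm (S t x) * exp (- \<omega> * t)) powr p"
  have Ku: "K_plus S u r = J *\<^sub>R S r x" if "r \<ge> a" for r
    using K_plus_eq[OF hr_cont that, of q x] that ab by (simp add: u_def[abs_def] J_def)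
  have G_ge: "c * h (t - r) powr p \<le> G r" if r: "t - r \<in> {0<..<b}" for r
  proof -
    \<comment> \<open>From \<open>t - r < b\<close> and \<open>t \<ge> a + b\<close> follows
      \<open>r > a\<close>, so \<open>Ku\<close> applies.\<close>
    have r': "r \<ge> a" "r \<ge> 0" "t - r \<ge> 0" using r ab by auto
    have "S t x = S (t - r) (S r x)"
      using add[of "t - r" r] r' by (simp add: fun_eq_iff)
    then have "norm (S t x) / m (t - r) \<le> norm (S r x)"
      using S_le[OF r'(3), of "S r x"] m_pos[OF r'(3)] by (simp add: divide_le_eq mult.commute)
    then have "J * exp (- \<omega> * r) * (norm (S t x) / m (t - r)) \<le> J * exp (- \<omega> * r) * norm (S r x)"
      using J_pos by (intro mult_left_mono) auto
    moreover have "J * norm (S t x) * exp (- \<omega> * t) * h (t - r) = J * exp (- \<omega> * r) * (norm (S t x) / m (t - r))"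
    proof -
      have "exp (- \<omega> * t) * exp (\<omega> * (t - r)) = exp (- \<omega> * r)"
        by (simp add: algebra_simps flip: exp_add)
      then show ?thesis by (simp add: h_def mult_ac)
    qed
    ultimately have "(J * norm (S t x) * exp (- \<omega> * t) * h (t - r)) powr p \<le>
        (J * exp (- \<omega> * r) * norm (S r x)) powr p"
      using p J_pos h_pos[OF r'(3)] by (intro powr_mono2) (simp_all del: times_divide_eq_right)
    also have "\<dots> = exp (- \<omega> * r) powr p * norm (K_plus S u r) powr p"
      using J_pos by (simp add: Ku[OF r'(1)] powr_mult mult_ac)
    also have "\<dots> = G r"
      by (simp add: G_def powr_def mult_ac)
    finally show ?thesis
      using J_pos h_pos[OF r'(3)] by (simp add: c_def powr_mult)
  qed
  have "integrable (lebesgue_on {0..}) G"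
    using C(2)[OF u] by (simp add: Lp_omega_def G_def[abs_def])
  then have G_int: "integrable lebesgue (\<lambda>r. indicator {0..} r * G r)"
    by (simp add: integrable_restrict_space)
  let ?g = "\<lambda>s. indicator {0<..<b} s * h s powr p"
  have g_meas [measurable]: "?g \<in> borel_measurable borel"
    using borel_measurable_integrable[OF integrable_continuous_Ioo[OF hr_cont]] by simp
  \<comment> \<open>The reflection of \<open>r\<close> to \<open>t - r\<close> carries
    \<open>]0,b[\<close> to \<open>]t-b,t[\<close>. The next step passes to \<open>lebesgue\<close>,
    the measure for which integrability of \<open>G\<close> is known.\<close>
  have "c * I = (LINT r|lborel. c * ?g (t - r))"
    using lborel_integral_real_affine[of "-1" ?g t] by (simp add: I_def)
  also have "\<dots> = (LINT r|lebesgue. c * ?g (t - r))"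
    by (intro integral_completion[symmetric]) measurable
  \<comment> \<open>Off \<open>]t-b,t[\<close> the left integrand vanishes while \<open>G\<close> is
    nonnegative, so the rest of the norm of \<open>K_plus S u\<close> is discarded.\<close>
  also have "\<dots> \<le> (LINT r|lebesgue. indicator {0..} r * G r)"
    using G_int
  proof (rule integral_mono')
    fix r
    show "0 \<le> indicator {0..} r * G r" by (simp add: G_def)
    then show "c * ?g (t - r) \<le> indicator {0..} r * G r"
      using G_ge[of r] ab by (cases "t - r \<in> {0<..<b}") (auto simp: indicator_def)
  qed
  also have "\<dots> = (LINT r|lebesgue_on {0..}. G r)"
    by (simp add: integral_restrict_space)
  finally have "(c * I) powr (1 / p) \<le> Lp_omega_norm \<omega> p (K_plus S u)"
    using p I_pos unfolding Lp_omega_norm_def G_def by (intro powr_mono2) (auto simp: c_def)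
  moreover have "(c * I) powr (1 / p) = J * norm (S t x) * exp (- \<omega> * t) * I powr (1 / p)"
    using p I_pos J_pos by (simp add: c_def powr_mult powr_powr)
  ultimately have "J * norm (S t x) * exp (- \<omega> * t) * I powr (1 / p) \<le> C * (norm x * J powr (1 / p))"
    using C(2)[OF u] mult_left_mono[OF u_le C(1)] by linarith
  \<comment> \<open>The factor \<open>J powr (1 / p)\<close> cancels against the bound for the norm
    of \<open>u\<close>; the remaining \<open>J powr (1 / q)\<close> is the weighted
    \<open>q\<close>-norm.\<close>
  moreover have "J = J powr (1 / p) * J powr (1 / q)"
    using J_pos pq by (simp flip: powr_add)
  ultimately have "J powr (1 / p) * (norm (S t x) * exp (- \<omega> * t) * (J powr (1 / q) * I powr (1 / p))) \<le>
      J powr (1 / p) * (C * norm x)"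
    by (metis (no_types, opaque_lifting) mult.assoc mult.commute mult.left_commute)
  then have "norm (S t x) * exp (- \<omega> * t) * (J powr (1 / q) * I powr (1 / p)) \<le> C * norm x"
    using J_pos by simp
  from mult_left_mono[OF this, of "exp (\<omega> * t)"] show ?thesis
    by (simp add: exp_minus field_simps)
qed

end

section \<open>From all admissible constants to the operator norm\<close>

theorem theorem1p2:
  fixes S :: "real \<Rightarrow> 'a::complex_banach \<Rightarrow> 'a"
    and \<omega> p q :: real and m :: "real \<Rightarrow> real"
  assumes "C0_semigroup S"
    and "p > 1" and "1 / p + 1 / q = 1"
    and "K_norm S \<omega> p < \<infinity>"
    and "continuous_on {0..} m" and "\<And>t. t \<ge> 0 \<Longrightarrow> m t > 0"
    and "\<And>t. t \<ge> 0 \<Longrightarrow> onorm (S t) \<le> m t"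
  shows "\<forall>t a b. t > 0 \<longrightarrow> a > 0 \<longrightarrow> b > 0 \<longrightarrow> t \<ge> a + b \<longrightarrow>
    onorm (S t) \<le> enn2real (K_norm S \<omega> p) *
      (exp (\<omega> * t) / (weighted_Lr_norm \<omega> q {0<..<a} (\<lambda>s. 1 / m s) *
        weighted_Lr_norm \<omega> p {0<..<b} (\<lambda>s. 1 / m s)))"
proof (intro allI impI)
  fix t a b :: real
  assume ab: "t > 0" "a > 0" "b > 0" "t \<ge> a + b"
  interpret C0_semigroup S by fact
  have norm_eq: "weighted_Lr_norm \<omega> r {0<..<c} (\<lambda>s. 1 / m s) =
      (LINT s|lborel. indicator {0<..<c} s * (exp (\<omega> * s) / m s) powr r) powr (1 / r)" for r c
    using assms(5,6) by (rule weighted_Lr_norm_inverse)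
  define N where "N = weighted_Lr_norm \<omega> q {0<..<a} (\<lambda>s. 1 / m s) *
    weighted_Lr_norm \<omega> p {0<..<b} (\<lambda>s. 1 / m s)"
  have "(LINT s|lborel. indicator {0<..<c} s * (exp (\<omega> * s) / m s) powr r) > 0" if "c > 0" for c r
  proof (intro LINT_Ioo_pos continuous_on_exp_divide_powr assms that)
    show "(exp (\<omega> * s) / m s) powr r > 0" if "s \<ge> 0" for s
      using assms(6)[OF that] by simp
  qed
  then have N_pos: "N > 0"
    using ab unfolding N_def norm_eq by (simp add: order_less_imp_not_eq2)
  \<comment> \<open>In this arrangement the left side is free of \<open>C\<close>, hence a lower
    bound for all admissible constants and so for their infimum.\<close>
  have "ennreal (onorm (S t) * N / exp (\<omega> * t)) \<le> K_norm S \<omega> p"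
    unfolding K_norm_def
  proof (rule INF_greatest, rule ennreal_leI)
    fix C
    assume "C \<in> {C. 0 \<le> C \<and> (\<forall>u \<in> Lp_omega \<omega> p. K_plus S u \<in> Lp_omega \<omega> p \<and>
      Lp_omega_norm \<omega> p (K_plus S u) \<le> C * Lp_omega_norm \<omega> p u)}"
    then have C: "0 \<le> C" "\<And>u. u \<in> Lp_omega \<omega> p \<Longrightarrow> K_plus S u \<in> Lp_omega \<omega> p \<and>
      Lp_omega_norm \<omega> p (K_plus S u) \<le> C * Lp_omega_norm \<omega> p u"
      by auto
    have "norm (S t x) * N \<le> C * exp (\<omega> * t) * norm x" for x
      unfolding N_def norm_eq
      using assms(2,3,5,6,7) C ab(2-4) by (rule norm_le_K_plus_constant)
    then have "norm (S t x) \<le> C * exp (\<omega> * t) / N * norm x" for x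
      using N_pos by (simp add: field_simps)
    then have "onorm (S t) \<le> C * exp (\<omega> * t) / N"
      using C(1) N_pos by (intro onorm_bound) auto
    then show "onorm (S t) * N / exp (\<omega> * t) \<le> C"
      using N_pos by (simp add: field_simps)
  qed
  \<comment> \<open>Finiteness of \<open>K_norm\<close> enters here: \<open>enn2real\<close> maps
    infinity to 0 and is monotone only below it.\<close>
  then have "enn2real (ennreal (onorm (S t) * N / exp (\<omega> * t))) \<le> enn2real (K_norm S \<omega> p)"
    using assms(4) by (intro enn2real_mono) auto
  \<comment> \<open>Nonnegativity is what lets \<open>enn2real\<close> undo \<open>ennreal\<close>,
    which truncates negative reals to 0.\<close>
  moreover have "0 \<le> onorm (S t)"
    using ab by (intro onorm_pos_le bounded_linear) simp
  ultimately have "onorm (S t) * N / exp (\<omega> * t) \<le> enn2real (K_norm S \<omega> p)"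
    using N_pos by simp
  then show "onorm (S t) \<le> enn2real (K_norm S \<omega> p) *
      (exp (\<omega> * t) / (weighted_Lr_norm \<omega> q {0<..<a} (\<lambda>s. 1 / m s) *
        weighted_Lr_norm \<omega> p {0<..<b} (\<lambda>s. 1 / m s)))"
    unfolding N_def[symmetric] using N_pos by (simp add: field_simps)
qed

end
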